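(* The unit ball and the unit simplex, endowed with their respective Baran metrics, i.e. the Riemannian manifolds $(B^n,g_{B^n})$ and $(S^n,g_{S^n})$, are Einstein manifolds: for each of them the metric tensor solves the Einstein vacuum field equation $\mathrm{Ric}=k\,g$ with a constant $k>0$.
   Context: $B^n=\{x\in\mathbb{R}^n:|x|<1\}$ with Baran metric $g_{B^n}$ represented at $x$ by the matrix with entries $\delta_{ij}+\frac{x_ix_j}{1-\sum_{k=1}^nx_k^2}$. $S^n=\{x\in\mathbb{R}^n:\sum_{i=1}^nx_i<1,\ x_i>0\ \forall i=1,\dots,n\}$ (the open simplex) with Baran metric $g_{S^n}$ represented at $x$ by the matrix with entries $\frac{\delta_{ij}}{x_i}+\frac{1}{1-\sum_{k=1}^nx_k}$. The Ricci tensor is $\mathrm{Ric}_{i,j}=\sum_{l=1}^n(\partial_l\Gamma^l_{j,i}-\partial_j\Gamma^l_{l,i})+\sum_{l,k=1}^n(\Gamma^l_{l,k}\Gamma^k_{j,i}-\Gamma^l_{j,k}\Gamma^k_{l,i})$, with $\Gamma^i_{j,k}$ the Christoffel symbols of the Levi-Civita connection of $g$.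
   Formalization: The dimension n is assumed to be at least 2; for n = 1 the Ricci tensor of any metric vanishes identically, so Ric = k g with a constant k > 0 is false for both the unit ball and the unit simplex. *)

theory Defs
  imports "HOL-Analysis.Analysis"
begin

text \<open>Tensor fields on an open subset of Euclidean space are written in the global coordinates:
  a field of bilinear forms is a matrix-valued function, with \<open>g x $ i $ j\<close> the entry
  of index \<open>(i, j)\<close> at the point \<open>x\<close>.\<close>

definition partial_deriv :: "'n::finite \<Rightarrow> (real^'n \<Rightarrow> real) \<Rightarrow> real^'n \<Rightarrow> real" where
  "partial_deriv i f x = deriv (\<lambda>t. f (x + t *\<^sub>R axis i 1)) 0"

text \<open>For open \<open>U\<close> this is being of class \<open>C\<close>-infinity: differentiability of every iterated
  partial derivative makes all of them continuous.\<close>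

definition smooth_fun_on :: "(real^'n::finite) set \<Rightarrow> (real^'n \<Rightarrow> real) \<Rightarrow> bool" where
  "smooth_fun_on U f \<longleftrightarrow> (\<forall>is. foldr partial_deriv is f differentiable_on U)"

definition riemannian_metric_on ::
    "(real^'n::finite) set \<Rightarrow> (real^'n \<Rightarrow> real^'n^'n) \<Rightarrow> bool" where
  "riemannian_metric_on U g \<longleftrightarrow>
     open U \<and>
     (\<forall>i j. smooth_fun_on U (\<lambda>x. g x $ i $ j)) \<and>
     (\<forall>x\<in>U. transpose (g x) = g x \<and> (\<forall>v. v \<noteq> 0 \<longrightarrow> 0 < v \<bullet> (g x *v v)))"

text \<open>\<open>christoffel g i j k x\<close> is the symbol with upper index \<open>i\<close> and lower indices \<open>j\<close>, \<open>k\<close>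
  of the Levi-Civita connection of \<open>g\<close>.\<close>

definition christoffel ::
    "(real^'n::finite \<Rightarrow> real^'n^'n) \<Rightarrow> 'n \<Rightarrow> 'n \<Rightarrow> 'n \<Rightarrow> real^'n \<Rightarrow> real" where
  "christoffel g i j k x =
     (\<Sum>m\<in>UNIV. matrix_inv (g x) $ i $ m *
        (partial_deriv j (\<lambda>y. g y $ m $ k) x
         + partial_deriv k (\<lambda>y. g y $ m $ j) x
         - partial_deriv m (\<lambda>y. g y $ j $ k) x)) / 2"

definition ricci :: "(real^'n::finite \<Rightarrow> real^'n^'n) \<Rightarrow> real^'n \<Rightarrow> real^'n^'n" where
  "ricci g x = (\<chi> i j.
     (\<Sum>l\<in>UNIV. partial_deriv l (christoffel g l j i) x - partial_deriv j (christoffel g l l i) x)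
     + (\<Sum>l\<in>UNIV. \<Sum>k\<in>UNIV. christoffel g l l k x * christoffel g k j i x
                           - christoffel g l j k x * christoffel g k l i x))"

definition einstein_manifold ::
    "real \<Rightarrow> (real^'n::finite) set \<Rightarrow> (real^'n \<Rightarrow> real^'n^'n) \<Rightarrow> bool" where
  "einstein_manifold k U g \<longleftrightarrow> riemannian_metric_on U g \<and> (\<forall>x\<in>U. ricci g x = k *\<^sub>R g x)"

definition baran_ball :: "real^'n::finite \<Rightarrow> real^'n^'n" where
  "baran_ball x = (\<chi> i j. (if i = j then 1 else 0) + x $ i * x $ j / (1 - (\<Sum>k\<in>UNIV. (x $ k)\<^sup>2)))"

definition open_simplex :: "(real^'n::finite) set" where
  "open_simplex = {x. (\<Sum>i\<in>UNIV. x $ i) < 1 \<and> (\<forall>i. 0 < x $ i)}"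

definition baran_simplex :: "real^'n::finite \<Rightarrow> real^'n^'n" where
  "baran_simplex x = (\<chi> i j. (if i = j then 1 else 0) / x $ i + 1 / (1 - (\<Sum>k\<in>UNIV. x $ k)))"

end

theory Submission
  imports Defs
begin

text \<open>
  Both metrics are pieces of round spheres. The graph map \<open>x \<mapsto> (x, sqrt (1 - \<bar>x\<bar>\<^sup>2))\<close> pulls the
  round metric of the unit sphere back to the ball metric, so the latter has curvature 1; and the substitution
  \<open>x\<^sub>i = y\<^sub>i\<^sup>2\<close> turns the simplex metric into 4 times the ball metric on the positive orthant, so it
  has curvature 1/4. With \<open>n\<close> the dimension, the Einstein constants are therefore
  \<open>n - 1\<close> and \<open>(n - 1) / 4\<close>, and they are positive because \<open>n \<ge> 2\<close>.

  Instead of transporting curvature along these isometries, the proof computes in the given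
  coordinates, which is feasible because everything closes up in terms of the metric itself.
  Let \<open>s\<close> be \<open>1 - \<Sum> x\<^sub>k\<^sup>2\<close> on the ball (\<open>ball_gap\<close>) and \<open>1 - \<Sum> x\<^sub>k\<close> on the simplex (\<open>simplex_gap\<close>). In both cases the inverse
  metric is a diagonal matrix minus \<open>x x\<^sup>T\<close>, and
  \<^item> on the ball, \<open>\<Gamma>\<^sup>i\<^sub>j\<^sub>k = x\<^sub>i g\<^sub>j\<^sub>k\<close> and \<open>\<Sum>\<^sub>l x\<^sub>l g\<^sub>l\<^sub>k = x\<^sub>k / s\<close>;
  \<^item> on the simplex, \<open>\<Gamma>\<^sup>i\<^sub>j\<^sub>k = (x\<^sub>i g\<^sub>j\<^sub>k - \<delta>\<^sub>i\<^sub>j\<^sub>k / x\<^sub>i) / 2\<close> and \<open>\<Sum>\<^sub>l x\<^sub>l g\<^sub>l\<^sub>k = 1 / s\<close>.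

  The contraction formulas evaluate all the sums in the Ricci tensor
  (\<open>ricci_baran_ball\<close>, \<open>ricci_baran_simplex\<close>). Smoothness holds because the entries are rational
  functions, a class closed under partial differentiation (\<open>rational_on_imp_smooth_fun_on\<close>).
\<close>

section \<open>Partial derivatives\<close>

text \<open>The relational form of \<open>partial_deriv\<close>: the usual differentiation rules can be
  composed for it, since each of them also delivers differentiability.\<close>

definition has_partial :: "'n::finite \<Rightarrow> (real^'n \<Rightarrow> real) \<Rightarrow> real \<Rightarrow> real^'n \<Rightarrow> bool" where
  "has_partial i f D x \<longleftrightarrow> ((\<lambda>t. f (x + t *\<^sub>R axis i 1)) has_real_derivative D) (at 0)"

lemma partial_deriv_eqI: "has_partial i f D x \<Longrightarrow> partial_deriv i f x = D"
  by (simp add: has_partial_def partial_deriv_def DERIV_imp_deriv)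

lemma has_partial_const: "has_partial i (\<lambda>x. c) 0 x"
  by (simp add: has_partial_def)

lemma has_partial_coord: "has_partial i (\<lambda>x. x $ k) (if i = k then 1 else 0) x"
  unfolding has_partial_def
  by (auto simp: axis_def intro!: derivative_eq_intros)

lemma has_partial_add:
  "has_partial i f D x \<Longrightarrow> has_partial i g E x \<Longrightarrow> has_partial i (\<lambda>x. f x + g x) (D + E) x"
  unfolding has_partial_def by (rule DERIV_add)

lemma has_partial_diff:
  "has_partial i f D x \<Longrightarrow> has_partial i g E x \<Longrightarrow> has_partial i (\<lambda>x. f x - g x) (D - E) x"
  unfolding has_partial_def by (rule DERIV_diff)

lemma has_partial_mult:
  "has_partial i f D x \<Longrightarrow> has_partial i g E x \<Longrightarrow>
   has_partial i (\<lambda>x. f x * g x) (D * g x + f x * E) x"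
  unfolding has_partial_def by (auto intro!: derivative_eq_intros)

lemma has_partial_inverse:
  "has_partial i f D x \<Longrightarrow> f x \<noteq> 0 \<Longrightarrow>
   has_partial i (\<lambda>x. inverse (f x)) (- (D * (inverse (f x) * inverse (f x)))) x"
  unfolding has_partial_def by (auto intro!: derivative_eq_intros)

lemma has_partial_divide:
  "has_partial i f D x \<Longrightarrow> has_partial i g E x \<Longrightarrow> g x \<noteq> 0 \<Longrightarrow>
   has_partial i (\<lambda>x. f x / g x) ((D * g x - f x * E) / (g x)\<^sup>2) x"
  unfolding has_partial_def by (auto intro!: derivative_eq_intros simp: power2_eq_square)

lemma has_partial_sum:
  "(\<And>k. k \<in> A \<Longrightarrow> has_partial i (f k) (D k) x) \<Longrightarrow>
   has_partial i (\<lambda>x. \<Sum>k\<in>A. f k x) (\<Sum>k\<in>A. D k) x"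
  unfolding has_partial_def by (rule DERIV_sum)

lemma eventually_axis_shift_in_open:
  fixes U :: "(real^'n::finite) set"
  assumes "open U" "x \<in> U"
  shows "\<forall>\<^sub>F t in nhds (0::real). x + t *\<^sub>R axis i 1 \<in> U"
proof -
  have "((\<lambda>t::real. x + t *\<^sub>R axis i 1) \<longlongrightarrow> x + 0 *\<^sub>R axis i 1) (nhds 0)"
    by (intro tendsto_intros filterlim_ident)
  then show ?thesis
    using assms by (auto dest: topological_tendstoD)
qed

text \<open>Needed to differentiate functions such as Christoffel symbols, whose closed form holds
  only on the domain of the metric.\<close>

lemma partial_deriv_cong_on:
  assumes "open U" "x \<in> U" "\<And>y. y \<in> U \<Longrightarrow> f y = g y"
  shows "partial_deriv i f x = partial_deriv i g x"
proof -
  have "\<forall>\<^sub>F t in nhds 0. f (x + t *\<^sub>R axis i 1) = g (x + t *\<^sub>R axis i 1)"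
    using eventually_axis_shift_in_open[OF assms(1,2)] by eventually_elim (rule assms(3))
  then show ?thesis
    unfolding partial_deriv_def by (rule deriv_cong_ev) simp
qed

section \<open>Smoothness of rational functions\<close>

text \<open>The constructors are few, so that closure under partial differentiation is a short
  induction; subtraction and division are derived from them. The condition on \<open>inverse\<close> excludes
  poles in \<open>U\<close>, where the convention \<open>inverse 0 = 0\<close> would break differentiability.\<close>

inductive rational_on :: "(real^'n::finite) set \<Rightarrow> (real^'n \<Rightarrow> real) \<Rightarrow> bool"
  for U where
  const: "rational_on U (\<lambda>x. c)"
| coord: "rational_on U (\<lambda>x. x $ i)"
| add: "rational_on U f \<Longrightarrow> rational_on U g \<Longrightarrow> rational_on U (\<lambda>x. f x + g x)"
| mult: "rational_on U f \<Longrightarrow> rational_on U g \<Longrightarrow> rational_on U (\<lambda>x. f x * g x)"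
| inverse: "rational_on U f \<Longrightarrow> (\<And>x. x \<in> U \<Longrightarrow> f x \<noteq> 0) \<Longrightarrow> rational_on U (\<lambda>x. inverse (f x))"

lemma rational_on_uminus: "rational_on U f \<Longrightarrow> rational_on U (\<lambda>x. - f x)"
  using rational_on.mult[OF rational_on.const[of U "-1"]] by simp

lemma rational_on_diff:
  "rational_on U f \<Longrightarrow> rational_on U g \<Longrightarrow> rational_on U (\<lambda>x. f x - g x)"
  using rational_on.add[OF _ rational_on_uminus] by simp

lemma rational_on_divide:
  "rational_on U f \<Longrightarrow> rational_on U g \<Longrightarrow> (\<And>x. x \<in> U \<Longrightarrow> g x \<noteq> 0) \<Longrightarrow>
   rational_on U (\<lambda>x. f x / g x)"
  unfolding divide_inverse by (intro rational_on.mult rational_on.inverse)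

lemma rational_on_sum:
  "(\<And>k. k \<in> A \<Longrightarrow> rational_on U (f k)) \<Longrightarrow> rational_on U (\<lambda>x. \<Sum>k\<in>A. f k x)"
  by (induction A rule: infinite_finite_induct)
     (auto intro: rational_on.const rational_on.add)

lemma rational_on_differentiable_on: "rational_on U f \<Longrightarrow> f differentiable_on U"
  by (induction rule: rational_on.induct)
     (auto simp: differentiable_on_def intro!: derivative_intros
        bounded_linear_imp_differentiable bounded_linear_vec_nth)

lemma rational_on_has_partial:
  assumes "rational_on U f"
  shows "\<exists>f'. rational_on U f' \<and> (\<forall>x\<in>U. has_partial i f (f' x) x)"
  using assms
proof induction
  case (const c)
  show ?case
    by (rule exI[of _ "\<lambda>x. 0"]) (simp add: has_partial_const rational_on.const)
next
  case (coord k)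
  show ?case
    by (rule exI[of _ "\<lambda>x. if i = k then 1 else 0"]) (simp add: has_partial_coord rational_on.const)
next
  case (add f g)
  then obtain f' g' where "rational_on U f'" "\<forall>x\<in>U. has_partial i f (f' x) x"
    "rational_on U g'" "\<forall>x\<in>U. has_partial i g (g' x) x" by blast
  then show ?case
    by (intro exI[of _ "\<lambda>x. f' x + g' x"]) (auto intro!: has_partial_add rational_on.add)
next
  case (mult f g)
  then obtain f' g' where "rational_on U f'" "\<forall>x\<in>U. has_partial i f (f' x) x"
    "rational_on U g'" "\<forall>x\<in>U. has_partial i g (g' x) x" by blast
  with mult.hyps show ?case
    by (intro exI[of _ "\<lambda>x. f' x * g x + f x * g' x"])
       (auto intro!: has_partial_mult rational_on.intros)
next
  case (inverse f)
  then obtain f' where "rational_on U f'" "\<forall>x\<in>U. has_partial i f (f' x) x" by blast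
  with inverse.hyps show ?case
    by (intro exI[of _ "\<lambda>x. - (f' x * (inverse (f x) * inverse (f x)))"])
       (auto intro!: has_partial_inverse rational_on_uminus rational_on.intros)
qed

text \<open>An iterated partial derivative of a rational function need not itself be rational as a
  total function, because the function may have poles outside \<open>U\<close>, where the differentiation rules
  say nothing about \<open>partial_deriv\<close>. The induction therefore only
  claims that it agrees on \<open>U\<close> with some rational function.\<close>

lemma rational_on_imp_smooth_fun_on:
  assumes "open U" "rational_on U f"
  shows "smooth_fun_on U f"
proof -
  have "\<exists>h. rational_on U h \<and> (\<forall>x\<in>U. foldr partial_deriv is f x = h x)" for "is"
  proof (induction "is")
    case Nil
    show ?case using assms(2) by auto
  next
    case (Cons i "is")
    then obtain h where h: "rational_on U h" "\<forall>x\<in>U. foldr partial_deriv is f x = h x"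
      by blast
    obtain h' where h': "rational_on U h'" "\<forall>x\<in>U. has_partial i h (h' x) x"
      using rational_on_has_partial[OF h(1)] by blast
    have "foldr partial_deriv (i # is) f x = h' x" if "x \<in> U" for x
      using partial_deriv_cong_on[OF assms(1) that, of "foldr partial_deriv is f" h i] h(2) h'(2) that
      by (simp add: partial_deriv_eqI)
    with h'(1) show ?case by blast
  qed
  then show ?thesis
    unfolding smooth_fun_on_def differentiable_on_def
    by (metis (no_types, lifting) rational_on_differentiable_on differentiable_on_def
          differentiable_transform_within zero_less_one)
qed

section \<open>Ricci tensors from closed-form Christoffel symbols\<close>

lemma matrix_inv_eqI:
  fixes A B :: "real^'n^'n"
  assumes "A ** B = mat 1"
  shows "matrix_inv A = B"
proof -
  have "B ** A = mat 1" using assms by (simp add: matrix_left_right_inverse)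
  with assms have "A ** matrix_inv A = mat 1"
    unfolding matrix_inv_def by (metis (mono_tags, lifting) someI)
  then show ?thesis
    by (metis \<open>B ** A = mat 1\<close> matrix_mul_assoc matrix_mul_lid matrix_mul_rid)
qed

text \<open>The trace \<open>\<Gamma>\<^sup>l\<^sub>l\<^sub>k\<close> is isolated in the third sum, since it is a simple function
  of \<open>x\<close> for both metrics. The fourth sum is left as a double sum: there the contractions
  of \<open>x\<close> with the metric separate only after the symbols are expanded.\<close>

lemma ricci_from_christoffel:
  fixes g :: "real^'n::finite \<Rightarrow> real^'n^'n"
  assumes "open U" "x \<in> U"
    and \<Gamma>: "\<And>i j k y. y \<in> U \<Longrightarrow> christoffel g i j k y = \<Gamma> i j k y"
    and d\<Gamma>: "\<And>l i j k. has_partial l (\<Gamma> i j k) (d\<Gamma> l i j k) x"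
  shows "ricci g x $ i $ j =
     (\<Sum>l\<in>UNIV. d\<Gamma> l l j i) - (\<Sum>l\<in>UNIV. d\<Gamma> j l l i)
     + (\<Sum>k\<in>UNIV. (\<Sum>l\<in>UNIV. \<Gamma> l l k x) * \<Gamma> k j i x)
     - (\<Sum>l\<in>UNIV. \<Sum>k\<in>UNIV. \<Gamma> l j k x * \<Gamma> k l i x)"
proof -
  have "partial_deriv l (christoffel g a b c) x = d\<Gamma> l a b c" for l a b c
    using partial_deriv_cong_on[OF assms(1,2), of "christoffel g a b c" "\<Gamma> a b c" l] \<Gamma>
      partial_deriv_eqI[OF d\<Gamma>] by simp
  moreover have "(\<Sum>l\<in>UNIV. \<Sum>k\<in>UNIV. \<Gamma> l l k x * \<Gamma> k j i x)
      = (\<Sum>k\<in>UNIV. (\<Sum>l\<in>UNIV. \<Gamma> l l k x) * \<Gamma> k j i x)"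
    unfolding sum_distrib_right by (rule sum.swap)
  ultimately show ?thesis
    by (simp add: ricci_def \<Gamma>[OF assms(2)] sum_subtractf)
qed

lemma delta_mult:
  "(if P then 1 else 0) * a = (if P then a else (0::real))"
    "a * (if P then 1 else 0) = (if P then a else (0::real))"
  by auto

section \<open>The ball\<close>

definition ball_gap :: "real^'n::finite \<Rightarrow> real" where
  "ball_gap x = 1 - (\<Sum>k\<in>UNIV. (x $ k)\<^sup>2)"

lemma ball_gap_pos: "x \<in> ball 0 1 \<Longrightarrow> 0 < ball_gap x"
proof -
  assume "x \<in> ball 0 1"
  then have "(norm x)\<^sup>2 < 1" by (simp add: power_less_one_iff abs_square_less_1)
  also have "(norm x)\<^sup>2 = (\<Sum>k\<in>UNIV. (x $ k)\<^sup>2)"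
    unfolding power2_norm_eq_inner by (simp add: inner_vec_def power2_eq_square)
  finally show ?thesis by (simp add: ball_gap_def)
qed

lemma sum_mult_self: "(\<Sum>k\<in>UNIV. x $ k * x $ k) = 1 - ball_gap x"
  by (simp add: ball_gap_def power2_eq_square)

lemma baran_ball_nth:
  "baran_ball x $ i $ j = (if i = j then 1 else 0) + x $ i * x $ j / ball_gap x"
  by (simp add: baran_ball_def ball_gap_def)

lemma baran_ball_commute: "baran_ball x $ i $ j = baran_ball x $ j $ i"
  by (simp add: baran_ball_nth mult.commute)

lemma baran_ball_contract:
  assumes "x \<in> ball 0 1"
  shows "(\<Sum>l\<in>UNIV. x $ l * baran_ball x $ l $ k) = x $ k / ball_gap x"
proof -
  have "(\<Sum>l\<in>UNIV. x $ l * baran_ball x $ l $ k)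
      = x $ k + (\<Sum>l\<in>UNIV. x $ l * x $ l) * (x $ k / ball_gap x)"
    by (simp add: baran_ball_nth algebra_simps sum.distrib delta_mult sum_distrib_left)
  also have "\<dots> = x $ k / ball_gap x"
    using ball_gap_pos[OF assms] by (simp add: sum_mult_self field_simps)
  finally show ?thesis .
qed

lemma has_partial_ball_gap: "has_partial i ball_gap (- 2 * x $ i) x"
proof -
  have "has_partial i (\<lambda>x. 1 - (\<Sum>k\<in>UNIV. x $ k * x $ k))
     (0 - (\<Sum>k\<in>UNIV. (if i = k then 1 else 0) * x $ k + x $ k * (if i = k then 1 else 0))) x"
    by (intro has_partial_diff has_partial_const has_partial_sum has_partial_mult has_partial_coord)
  then show ?thesis
    by (simp add: ball_gap_def[abs_def] power2_eq_square delta_mult sum_distrib_left[symmetric])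
qed

text \<open>Expressing the derivative through the metric, rather than through coordinates, is what
  keeps the later computations short: the pieces of \<open>\<partial>\<^sub>l g\<^sub>j\<^sub>k\<close> that contain deltas combine with the
  derivative of \<open>1 / s\<close> into full metric coefficients.\<close>

lemma has_partial_baran_ball:
  assumes "x \<in> ball 0 1"
  shows "has_partial l (\<lambda>y. baran_ball y $ j $ k)
     ((x $ k * baran_ball x $ l $ j + x $ j * baran_ball x $ l $ k) / ball_gap x) x"
proof -
  have s: "ball_gap x \<noteq> 0" using ball_gap_pos[OF assms] by simp
  have "has_partial l (\<lambda>y. baran_ball y $ j $ k)
    (0 + (((if l = j then 1 else 0) * x $ k + x $ j * (if l = k then 1 else 0)) * ball_gap x
       - x $ j * x $ k * (- 2 * x $ l)) / (ball_gap x)\<^sup>2) x"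
    unfolding baran_ball_nth
    by (intro has_partial_add has_partial_const has_partial_divide has_partial_mult
          has_partial_coord has_partial_ball_gap s)
  then show ?thesis
    by (rule back_subst[of "\<lambda>D. has_partial l _ D x"])
       (use s in \<open>simp add: baran_ball_nth field_simps power2_eq_square\<close>)
qed

text \<open>A rank-one perturbation of the identity has an inverse of the same kind
  (Sherman-Morrison); here the factor \<open>1 / s\<close> cancels.\<close>

lemma matrix_inv_baran_ball:
  assumes "x \<in> ball 0 1"
  shows "matrix_inv (baran_ball x) = (\<chi> i j. (if i = j then 1 else 0) - x $ i * x $ j)"
proof (rule matrix_inv_eqI)
  have "(\<Sum>k\<in>UNIV. baran_ball x $ i $ k * ((if k = j then 1 else 0) - x $ k * x $ j))
     = baran_ball x $ i $ j - (\<Sum>k\<in>UNIV. x $ k * baran_ball x $ k $ i) * x $ j" for i j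
    by (simp add: algebra_simps sum_subtractf delta_mult sum_distrib_left
          baran_ball_commute[of x i])
  then show "baran_ball x ** (\<chi> i j. (if i = j then 1 else 0) - x $ i * x $ j) = mat 1"
    by (simp add: vec_eq_iff matrix_matrix_mult_def mat_def baran_ball_contract[OF assms])
       (simp add: baran_ball_nth)
qed

text \<open>The bracket \<open>\<partial>\<^sub>j g\<^sub>m\<^sub>k + \<partial>\<^sub>k g\<^sub>m\<^sub>j - \<partial>\<^sub>m g\<^sub>j\<^sub>k\<close> collapses to \<open>2 x\<^sub>m g\<^sub>j\<^sub>k / s\<close>, and the inverse metric maps
  \<open>x\<close> to \<open>s x\<close>.\<close>

lemma christoffel_baran_ball:
  assumes "x \<in> ball 0 1"
  shows "christoffel baran_ball i j k x = x $ i * baran_ball x $ j $ k"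
proof -
  have s: "ball_gap x \<noteq> 0" using ball_gap_pos[OF assms] by simp
  have "(x $ k * baran_ball x $ j $ m + x $ m * baran_ball x $ j $ k) / ball_gap x
      + (x $ j * baran_ball x $ k $ m + x $ m * baran_ball x $ k $ j) / ball_gap x
      - (x $ k * baran_ball x $ m $ j + x $ j * baran_ball x $ m $ k) / ball_gap x
      = x $ m * (2 * baran_ball x $ j $ k / ball_gap x)" for m
    using s by (simp add: baran_ball_commute field_simps)
  then have "christoffel baran_ball i j k x
     = (\<Sum>m\<in>UNIV. ((if i = m then 1 else 0) - x $ i * x $ m) * (x $ m * (2 * baran_ball x $ j $ k / ball_gap x))) / 2"
    unfolding christoffel_def matrix_inv_baran_ball[OF assms]
      partial_deriv_eqI[OF has_partial_baran_ball[OF assms]]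
    by simp
  also have "\<dots> = (\<Sum>m\<in>UNIV. (if i = m then x $ m else 0) - x $ i * (x $ m * x $ m))
      * (2 * baran_ball x $ j $ k / ball_gap x) / 2"
    unfolding sum_distrib_right
    by (intro arg_cong2[where f = "(/)"] sum.cong) (auto simp: left_diff_distrib)
  also have "\<dots> = (x $ i - x $ i * (\<Sum>m\<in>UNIV. x $ m * x $ m)) * (baran_ball x $ j $ k / ball_gap x)"
    by (simp add: sum_subtractf sum_distrib_left)
  also have "\<dots> = x $ i * baran_ball x $ j $ k"
    using s by (simp add: sum_mult_self right_diff_distrib)
  finally show ?thesis .
qed

text \<open>Beyond \<open>(n - 1) g\<^sub>i\<^sub>j\<close>, the derivative terms leave \<open>x\<^sub>i x\<^sub>j / s\<^sup>2\<close> and \<open>- (1 - s) / s g\<^sub>i\<^sub>j\<close>; the quadratic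
  terms cancel exactly these two.\<close>

lemma ricci_baran_ball:
  fixes x :: "real^'n::finite"
  assumes x: "x \<in> ball 0 1"
  shows "ricci baran_ball x = (real CARD('n) - 1) *\<^sub>R baran_ball x"
proof -
  let ?g = "baran_ball x" and ?s = "ball_gap x"
  have "ricci baran_ball x $ i $ j = (real CARD('n) - 1) * ?g $ i $ j" for i j
  proof -
    have "has_partial l (\<lambda>y. y $ a * baran_ball y $ b $ c)
       ((if l = a then 1 else 0) * ?g $ b $ c
        + x $ a * ((x $ c * ?g $ l $ b + x $ b * ?g $ l $ c) / ?s)) x" for l a b c
      by (intro has_partial_mult has_partial_coord has_partial_baran_ball x)
    from ricci_from_christoffel[OF open_ball x christoffel_baran_ball this, where i = i and j = j]
    have "ricci baran_ball x $ i $ j =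
      (\<Sum>l\<in>UNIV. ?g $ j $ i + x $ l * ((x $ i * ?g $ l $ j + x $ j * ?g $ l $ i) / ?s))
      - (\<Sum>l\<in>UNIV. (if j = l then 1 else 0) * ?g $ l $ i
           + x $ l * ((x $ i * ?g $ j $ l + x $ l * ?g $ j $ i) / ?s))
      + (\<Sum>k\<in>UNIV. (\<Sum>l\<in>UNIV. x $ l * ?g $ l $ k) * (x $ k * ?g $ j $ i))
      - (\<Sum>l\<in>UNIV. \<Sum>k\<in>UNIV. x $ l * ?g $ j $ k * (x $ k * ?g $ l $ i))"
      by simp
    moreover have "(\<Sum>l\<in>UNIV. ?g $ j $ i + x $ l * ((x $ i * ?g $ l $ j + x $ j * ?g $ l $ i) / ?s))
       = real CARD('n) * ?g $ i $ j + 2 * (x $ i * x $ j) / ?s\<^sup>2"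
    proof -
      have "(\<Sum>l\<in>UNIV. ?g $ j $ i + x $ l * ((x $ i * ?g $ l $ j + x $ j * ?g $ l $ i) / ?s))
         = real CARD('n) * ?g $ j $ i + (x $ i * (\<Sum>l\<in>UNIV. x $ l * ?g $ l $ j)
            + x $ j * (\<Sum>l\<in>UNIV. x $ l * ?g $ l $ i)) / ?s"
        by (simp add: sum.distrib sum_distrib_left sum_divide_distrib[symmetric] algebra_simps)
      then show ?thesis
        by (simp add: baran_ball_contract[OF x] baran_ball_commute[of x j] power2_eq_square)
    qed
    moreover have "(\<Sum>l\<in>UNIV. (if j = l then 1 else 0) * ?g $ l $ i
           + x $ l * ((x $ i * ?g $ j $ l + x $ l * ?g $ j $ i) / ?s))
       = ?g $ i $ j + x $ i * x $ j / ?s\<^sup>2 + (1 - ?s) / ?s * ?g $ i $ j"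
    proof -
      have "(\<Sum>l\<in>UNIV. (if j = l then 1 else 0) * ?g $ l $ i
           + x $ l * ((x $ i * ?g $ j $ l + x $ l * ?g $ j $ i) / ?s))
         = ?g $ j $ i + (x $ i * (\<Sum>l\<in>UNIV. x $ l * ?g $ l $ j)
            + (\<Sum>l\<in>UNIV. x $ l * x $ l) * ?g $ j $ i) / ?s"
        by (simp add: sum.distrib sum_distrib_left sum_distrib_right sum_divide_distrib[symmetric]
            algebra_simps delta_mult baran_ball_commute[of x _ j])
      then show ?thesis
        by (simp add: baran_ball_contract[OF x] baran_ball_commute[of x j] power2_eq_square
            sum_mult_self add_divide_distrib)
    qed
    moreover have "(\<Sum>k\<in>UNIV. (\<Sum>l\<in>UNIV. x $ l * ?g $ l $ k) * (x $ k * ?g $ j $ i))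
       = (1 - ?s) / ?s * ?g $ i $ j"
    proof -
      have "(\<Sum>k\<in>UNIV. (\<Sum>l\<in>UNIV. x $ l * ?g $ l $ k) * (x $ k * ?g $ j $ i))
        = (\<Sum>k\<in>UNIV. x $ k * x $ k) / ?s * ?g $ i $ j"
        unfolding baran_ball_contract[OF x] sum_divide_distrib sum_distrib_right
        by (simp add: baran_ball_commute[of x j] mult.assoc)
      then show ?thesis by (simp add: sum_mult_self)
    qed
    moreover have "(\<Sum>l\<in>UNIV. \<Sum>k\<in>UNIV. x $ l * ?g $ j $ k * (x $ k * ?g $ l $ i)) = x $ i * x $ j / ?s\<^sup>2"
    proof -
      have "(\<Sum>l\<in>UNIV. \<Sum>k\<in>UNIV. x $ l * ?g $ j $ k * (x $ k * ?g $ l $ i))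
        = (\<Sum>l\<in>UNIV. x $ l * ?g $ l $ i) * (\<Sum>k\<in>UNIV. x $ k * ?g $ k $ j)"
        unfolding sum_product by (simp add: baran_ball_commute[of x j] mult_ac)
      then show ?thesis by (simp add: baran_ball_contract[OF x] power2_eq_square)
    qed
    ultimately show ?thesis by (simp add: algebra_simps)
  qed
  then show ?thesis by (simp add: vec_eq_iff)
qed

lemma riemannian_metric_on_baran_ball:
  "riemannian_metric_on (ball 0 1) (baran_ball :: real^'n::finite \<Rightarrow> _)"
  unfolding riemannian_metric_on_def
proof (intro conjI allI ballI impI)
  show "open (ball 0 1 :: (real^'n) set)" by simp
next
  fix i j :: 'n
  have "rational_on (ball 0 1) (\<lambda>x::real^'n. baran_ball x $ i $ j)"
    unfolding baran_ball_nth ball_gap_def power2_eq_square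
    using ball_gap_pos unfolding ball_gap_def power2_eq_square
    by (intro rational_on.add rational_on.const rational_on_divide rational_on.mult rational_on.coord
         rational_on_diff rational_on_sum) fastforce
  then show "smooth_fun_on (ball 0 1) (\<lambda>x::real^'n. baran_ball x $ i $ j)"
    by (simp add: rational_on_imp_smooth_fun_on)
next
  fix x :: "real^'n"
  show "transpose (baran_ball x) = baran_ball x"
    by (simp add: transpose_def vec_eq_iff baran_ball_commute)
next
  fix x v :: "real^'n"
  assume x: "x \<in> ball 0 1" and v: "v \<noteq> 0"
  have "baran_ball x *v v = v + ((x \<bullet> v) / ball_gap x) *\<^sub>R x"
    by (simp add: vec_eq_iff matrix_vector_mult_def baran_ball_nth inner_vec_def algebra_simps
         sum.distrib delta_mult sum_distrib_left sum_divide_distrib)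
  then have "v \<bullet> (baran_ball x *v v) = v \<bullet> v + (x \<bullet> v)\<^sup>2 / ball_gap x"
    by (simp add: inner_add_right power2_eq_square inner_commute)
  also have "\<dots> > 0"
    using v ball_gap_pos[OF x] by (intro add_pos_nonneg) auto
  finally show "0 < v \<bullet> (baran_ball x *v v)" .
qed

section \<open>The simplex\<close>

definition simplex_gap :: "real^'n::finite \<Rightarrow> real" where
  "simplex_gap x = 1 - (\<Sum>k\<in>UNIV. x $ k)"

lemma sum_coords: "(\<Sum>k\<in>UNIV. x $ k) = 1 - simplex_gap x"
  by (simp add: simplex_gap_def)

lemma open_simplexD:
  assumes "x \<in> open_simplex"
  shows "0 < simplex_gap x" "0 < x $ i"
  using assms by (simp_all add: open_simplex_def simplex_gap_def)

lemma open_open_simplex: "open (open_simplex :: (real^'n::finite) set)"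
  unfolding open_simplex_def
  by (simp add: Collect_conj_eq Collect_all_eq open_Int open_INT open_Collect_less continuous_intros)

lemma baran_simplex_nth:
  "baran_simplex x $ i $ j = (if i = j then 1 / x $ i else 0) + 1 / simplex_gap x"
  by (simp add: baran_simplex_def simplex_gap_def)

lemma baran_simplex_commute: "baran_simplex x $ i $ j = baran_simplex x $ j $ i"
  by (simp add: baran_simplex_nth)

lemma baran_simplex_contract:
  assumes "x \<in> open_simplex"
  shows "(\<Sum>l\<in>UNIV. x $ l * baran_simplex x $ l $ k) = 1 / simplex_gap x"
proof -
  have "(\<Sum>l\<in>UNIV. x $ l * baran_simplex x $ l $ k)
      = (\<Sum>l\<in>UNIV. (if l = k then 1 else 0) + x $ l / simplex_gap x)"
    using open_simplexD(2)[OF assms, THEN less_imp_neq]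
    by (intro sum.cong) (auto simp: baran_simplex_nth algebra_simps)
  also have "\<dots> = 1 / simplex_gap x"
    using open_simplexD(1)[OF assms]
    by (simp add: sum.distrib sum_divide_distrib[symmetric] sum_coords diff_divide_distrib)
  finally show ?thesis .
qed

lemma has_partial_simplex_gap: "has_partial i simplex_gap (- 1) x"
proof -
  have "has_partial i (\<lambda>x. 1 - (\<Sum>k\<in>UNIV. x $ k)) (0 - (\<Sum>k\<in>UNIV. (if i = k then 1 else 0))) x"
    by (intro has_partial_diff has_partial_const has_partial_sum has_partial_coord)
  then show ?thesis by (simp add: simplex_gap_def[abs_def])
qed

lemma has_partial_baran_simplex:
  assumes "x \<in> open_simplex"
  shows "has_partial l (\<lambda>y. baran_simplex y $ j $ k)
     (1 / (simplex_gap x)\<^sup>2 - (if l = j \<and> j = k then 1 / (x $ j)\<^sup>2 else 0)) x"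
proof -
  have s: "simplex_gap x \<noteq> 0" "x $ j \<noteq> 0"
    using open_simplexD(1)[OF assms] open_simplexD(2)[OF assms, of j] by auto
  have "has_partial l (\<lambda>y. (if j = k then 1 else 0) / y $ j + 1 / simplex_gap y)
    ((0 * x $ j - (if j = k then 1 else 0) * (if l = j then 1 else 0)) / (x $ j)\<^sup>2
     + (0 * simplex_gap x - 1 * (- 1)) / (simplex_gap x)\<^sup>2) x"
    by (intro has_partial_add has_partial_const has_partial_divide
          has_partial_coord has_partial_simplex_gap s)
  moreover have "(\<lambda>y. baran_simplex y $ j $ k)
      = (\<lambda>y. (if j = k then 1 else 0) / y $ j + 1 / simplex_gap y)"
    by (auto simp: baran_simplex_nth)
  ultimately show ?thesis by (auto split: if_splits)
qed

lemma matrix_inv_baran_simplex: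
  assumes "x \<in> open_simplex"
  shows "matrix_inv (baran_simplex x) = (\<chi> i j. (if i = j then x $ i else 0) - x $ i * x $ j)"
proof (rule matrix_inv_eqI)
  have "(\<Sum>k\<in>UNIV. baran_simplex x $ i $ k * ((if k = j then x $ k else 0) - x $ k * x $ j))
     = baran_simplex x $ i $ j * x $ j - (\<Sum>k\<in>UNIV. x $ k * baran_simplex x $ k $ i) * x $ j" for i j
    by (simp add: algebra_simps sum_subtractf if_distrib[of "\<lambda>a. _ * a"] sum_distrib_left
          baran_simplex_commute[of x i] cong: if_cong)
  then show "baran_simplex x ** (\<chi> i j. (if i = j then x $ i else 0) - x $ i * x $ j) = mat 1"
    using open_simplexD[OF assms, THEN less_imp_neq]
    by (simp add: vec_eq_iff matrix_matrix_mult_def mat_def baran_simplex_contract[OF assms])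
       (simp add: baran_simplex_nth distrib_right)
qed

text \<open>The three derivatives of the metric in the Christoffel symbol are all equal, because
  \<open>\<partial>\<^sub>l g\<^sub>j\<^sub>k\<close> is symmetric in all three indices: the metric is the Hessian of the negative entropy
  \<open>\<Sum> x\<^sub>i ln x\<^sub>i + s ln s\<close>. Hence the bracket is a single derivative.\<close>

lemma christoffel_baran_simplex:
  assumes "x \<in> open_simplex"
  shows "christoffel baran_simplex i j k x
    = (x $ i * baran_simplex x $ j $ k - (if i = j \<and> j = k then 1 / x $ i else 0)) / 2"
proof -
  note pos = open_simplexD[OF assms, THEN less_imp_neq, symmetric]
  let ?s = "simplex_gap x"
  have "christoffel baran_simplex i j k x
     = (\<Sum>m\<in>UNIV. ((if i = m then x $ i else 0) - x $ i * x $ m)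
         * (1 / ?s\<^sup>2 - (if m = j then if j = k then 1 / (x $ j)\<^sup>2 else 0 else 0))) / 2"
    unfolding christoffel_def matrix_inv_baran_simplex[OF assms]
      partial_deriv_eqI[OF has_partial_baran_simplex[OF assms]]
    by (intro arg_cong2[where f = "(/)"] sum.cong refl) auto
  also have "(\<Sum>m\<in>UNIV. ((if i = m then x $ i else 0) - x $ i * x $ m)
         * (1 / ?s\<^sup>2 - (if m = j then if j = k then 1 / (x $ j)\<^sup>2 else 0 else 0)))
     = (\<Sum>m\<in>UNIV. (if i = m then x $ i * (1 / ?s\<^sup>2 - (if i = j then if j = k then 1 / (x $ j)\<^sup>2 else 0 else 0)) else 0)
         - (x $ i / ?s\<^sup>2) * x $ m
         + (if m = j then x $ i * x $ j * (if j = k then 1 / (x $ j)\<^sup>2 else 0) else 0))"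
    by (intro sum.cong) (auto simp: algebra_simps)
  also have "\<dots> = x $ i * (1 / ?s\<^sup>2 - (if i = j then if j = k then 1 / (x $ j)\<^sup>2 else 0 else 0))
      - (x $ i / ?s\<^sup>2) * (\<Sum>m\<in>UNIV. x $ m) + x $ i * x $ j * (if j = k then 1 / (x $ j)\<^sup>2 else 0)"
    unfolding sum.distrib sum_subtractf sum_distrib_left by simp
  also have "\<dots> = x $ i * baran_simplex x $ j $ k - (if i = j \<and> j = k then 1 / x $ i else 0)"
    using pos unfolding sum_coords by (auto simp: baran_simplex_nth field_simps power2_eq_square)
  finally show ?thesis .
qed

text \<open>Applied below only with two of the indices \<open>l\<close>, \<open>a\<close>, \<open>b\<close> equal, where the deltas collapse.
  The quotient rule is used with the delta as a numerator, which is then moved inside.\<close>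

lemma has_partial_christoffel_baran_simplex:
  assumes x: "x \<in> open_simplex"
  shows "has_partial l
     (\<lambda>y. (y $ a * baran_simplex y $ b $ c - (if a = b \<and> b = c then 1 / y $ a else 0)) / 2)
     (((if l = a then baran_simplex x $ b $ c else 0)
       + x $ a * (1 / (simplex_gap x)\<^sup>2 - (if l = b \<and> b = c then 1 / (x $ b)\<^sup>2 else 0))
       + (if l = a \<and> a = b \<and> b = c then 1 / (x $ a)\<^sup>2 else 0)) / 2) x"
proof -
  let ?g = "baran_simplex x" and ?s = "simplex_gap x"
  note pos = open_simplexD(2)[OF x, THEN less_imp_neq, symmetric]
  have "has_partial l
     (\<lambda>y. (y $ a * baran_simplex y $ b $ c - (if a = b \<and> b = c then 1 else 0) / y $ a) / 2)
     (((((if l = a then 1 else 0) * ?g $ b $ c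
        + x $ a * (1 / ?s\<^sup>2 - (if l = b \<and> b = c then 1 / (x $ b)\<^sup>2 else 0)))
        - (0 * x $ a - (if a = b \<and> b = c then 1 else 0) * (if l = a then 1 else 0)) / (x $ a)\<^sup>2) * 2
       - (x $ a * ?g $ b $ c - (if a = b \<and> b = c then 1 else 0) / x $ a) * 0) / 2\<^sup>2) x"
    by (intro has_partial_mult has_partial_diff has_partial_divide has_partial_const
          has_partial_coord has_partial_baran_simplex x pos) simp
  moreover have "(\<lambda>y. (y $ a * baran_simplex y $ b $ c - (if a = b \<and> b = c then 1 else 0) / y $ a) / 2)
      = (\<lambda>y. (y $ a * baran_simplex y $ b $ c - (if a = b \<and> b = c then 1 / y $ a else 0)) / 2)"
    by auto
  ultimately have *: "has_partial l
     (\<lambda>y. (y $ a * baran_simplex y $ b $ c - (if a = b \<and> b = c then 1 / y $ a else 0)) / 2)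
     (((((if l = a then 1 else 0) * ?g $ b $ c
        + x $ a * (1 / ?s\<^sup>2 - (if l = b \<and> b = c then 1 / (x $ b)\<^sup>2 else 0)))
        - (0 * x $ a - (if a = b \<and> b = c then 1 else 0) * (if l = a then 1 else 0)) / (x $ a)\<^sup>2) * 2
       - (x $ a * ?g $ b $ c - (if a = b \<and> b = c then 1 else 0) / x $ a) * 0) / 2\<^sup>2) x"
    by simp
  show ?thesis
    by (rule back_subst[of "\<lambda>D. has_partial l _ D x", OF *]) auto
qed

text \<open>Each of the four sums is reduced to \<open>g\<^sub>i\<^sub>j\<close>, \<open>s\<close> and the diagonal terms \<open>\<delta>\<^sub>i\<^sub>j / x\<^sub>i\<close>,
  \<open>\<delta>\<^sub>i\<^sub>j / x\<^sub>i\<^sup>2\<close> (\<open>d\<close> and \<open>d2\<close> in the proof). All occurrences of \<open>\<delta>\<^sub>i\<^sub>j / x\<^sub>i\<^sup>2\<close> cancel, and what is left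
  becomes a multiple of \<open>g\<^sub>i\<^sub>j\<close> by \<open>g\<^sub>i\<^sub>j = \<delta>\<^sub>i\<^sub>j / x\<^sub>i + 1 / s\<close> and this equation divided by \<open>s\<close>.\<close>

lemma ricci_baran_simplex:
  fixes x :: "real^'n::finite"
  assumes x: "x \<in> open_simplex"
  shows "ricci baran_simplex x = ((real CARD('n) - 1) / 4) *\<^sub>R baran_simplex x"
proof -
  let ?g = "baran_simplex x" and ?s = "simplex_gap x"
  note pos = open_simplexD[OF assms, THEN less_imp_neq, symmetric]
  have "ricci baran_simplex x $ i $ j = (real CARD('n) - 1) / 4 * ?g $ i $ j" for i j
  proof -
    define d where "d = (if i = j then 1 / x $ i else 0)"
    define d2 where "d2 = (if i = j then 1 / (x $ i)\<^sup>2 else 0)"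
    \<comment> \<open>Products of deltas are multiplied out by this rule and then simplified one by one:
      a case distinction on all index equalities at once would multiply the cases.\<close>
    have expand: "(p - q) / 2 * ((r - t) / 2) = (p * r - p * t - q * r + q * t) / 4"
      for p q r t :: real
      by (simp add: field_simps)
    note ric = ricci_from_christoffel[OF open_open_simplex x christoffel_baran_simplex
        has_partial_christoffel_baran_simplex[OF x], where i = i and j = j]
    have "ricci baran_simplex x $ i $ j =
      (\<Sum>l\<in>UNIV. (?g $ j $ i
        + x $ l * (1 / ?s\<^sup>2 - (if l = j \<and> j = i then 1 / (x $ j)\<^sup>2 else 0))
        + (if l = j \<and> j = i then 1 / (x $ l)\<^sup>2 else 0)) / 2)
      - (\<Sum>l\<in>UNIV. ((if j = l then ?g $ l $ i else 0)
        + x $ l * (1 / ?s\<^sup>2 - (if j = l \<and> l = i then 1 / (x $ l)\<^sup>2 else 0))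
        + (if j = l \<and> l = i then 1 / (x $ l)\<^sup>2 else 0)) / 2)
      + (\<Sum>k\<in>UNIV. (\<Sum>l\<in>UNIV. (x $ l * ?g $ l $ k - (if l = k then 1 / x $ l else 0)) / 2)
           * ((x $ k * ?g $ j $ i - (if k = j \<and> j = i then 1 / x $ k else 0)) / 2))
      - (\<Sum>l\<in>UNIV. \<Sum>k\<in>UNIV. (x $ l * ?g $ j $ k - (if l = j \<and> j = k then 1 / x $ l else 0)) / 2
           * ((x $ k * ?g $ l $ i - (if k = l \<and> l = i then 1 / x $ k else 0)) / 2))"
      (is "_ = ?A - ?B + ?C - ?D")
      by (rule trans[OF ric], assumption) (simp only: simp_thms if_True)
    moreover have "?A = (real CARD('n) * ?g $ i $ j + (1 - ?s) / ?s\<^sup>2 - d + d2) / 2"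
    proof -
      have "?A = (\<Sum>l\<in>UNIV. ?g $ i $ j + x $ l * (1 / ?s\<^sup>2) + (if l = j then d2 - d else 0)) / 2"
        unfolding sum_divide_distrib using pos
        by (intro sum.cong) (auto simp: d_def d2_def baran_simplex_commute[of x j] power2_eq_square field_simps)
      also have "\<dots> = (real CARD('n) * ?g $ i $ j + (1 - ?s) / ?s\<^sup>2 - d + d2) / 2"
        by (simp add: sum.distrib sum_distrib_right[symmetric] sum_coords sum_divide_distrib[symmetric])
      finally show ?thesis .
    qed
    moreover have "?B = (?g $ i $ j + (1 - ?s) / ?s\<^sup>2 - d + d2) / 2"
    proof -
      have "?B = (\<Sum>l\<in>UNIV. x $ l * (1 / ?s\<^sup>2) + (if l = j then ?g $ i $ j + d2 - d else 0)) / 2"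
        unfolding sum_divide_distrib using pos
        by (intro sum.cong) (auto simp: d_def d2_def baran_simplex_commute[of x j] power2_eq_square field_simps)
      also have "\<dots> = (?g $ i $ j + (1 - ?s) / ?s\<^sup>2 - d + d2) / 2"
        by (simp add: sum.distrib sum_distrib_right[symmetric] sum_coords sum_divide_distrib[symmetric])
      finally show ?thesis .
    qed
    moreover have "?C = ((1 - ?s) / ?s * ?g $ i $ j - real CARD('n) * ?g $ i $ j - d / ?s + d2) / 4"
    proof -
      have "(\<Sum>l\<in>UNIV. (x $ l * ?g $ l $ k - (if l = k then 1 / x $ l else 0)) / 2)
         = (1 / ?s - 1 / x $ k) / 2" for k
        by (simp add: sum_divide_distrib[symmetric] sum_subtractf baran_simplex_contract[OF x])
      moreover have "1 / ?s * (x $ k * ?g $ j $ i) = x $ k * (?g $ i $ j / ?s)"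
        "1 / ?s * (if k = j \<and> j = i then 1 / x $ k else 0) = (if k = j then d / ?s else 0)"
        "1 / x $ k * (x $ k * ?g $ j $ i) = ?g $ i $ j"
        "1 / x $ k * (if k = j \<and> j = i then 1 / x $ k else 0) = (if k = j then d2 else 0)" for k
        using pos(2) by (auto simp: d_def d2_def baran_simplex_commute[of x j] power2_eq_square)
      ultimately have "?C = (\<Sum>k\<in>UNIV. x $ k * (?g $ i $ j / ?s) - (if k = j then d / ?s else 0)
           - ?g $ i $ j + (if k = j then d2 else 0)) / 4"
        by (simp only: expand sum_divide_distrib)
      also have "\<dots> = ((1 - ?s) / ?s * ?g $ i $ j - real CARD('n) * ?g $ i $ j - d / ?s + d2) / 4"
        by (simp add: sum.distrib sum_subtractf sum_distrib_right[symmetric] sum_coords sum_divide_distrib[symmetric])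
      finally show ?thesis .
    qed
    moreover have "?D = (1 / ?s\<^sup>2 - 2 * ?g $ i $ j + d2) / 4"
    proof -
      have "x $ l * ?g $ j $ k * (if k = l \<and> l = i then 1 / x $ k else 0)
           = (if k = l then if l = i then ?g $ j $ i else 0 else 0)"
        "(if l = j \<and> j = k then 1 / x $ l else 0) * (x $ k * ?g $ l $ i)
           = (if k = j then if l = j then ?g $ j $ i else 0 else 0)"
        "(if l = j \<and> j = k then 1 / x $ l else 0) * (if k = l \<and> l = i then 1 / x $ k else 0)
           = (if k = j then if l = j then d2 else 0 else 0)"
        "x $ l * ?g $ j $ k * (x $ k * ?g $ l $ i) = (x $ l * ?g $ l $ i) * (x $ k * ?g $ k $ j)"
        for l k
        using pos(2) by (auto simp: d2_def power2_eq_square baran_simplex_commute[of x j])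
      then have "?D = (\<Sum>l\<in>UNIV. \<Sum>k\<in>UNIV. (x $ l * ?g $ l $ i) * (x $ k * ?g $ k $ j)
          - (if k = l then if l = i then ?g $ j $ i else 0 else 0)
          - (if k = j then if l = j then ?g $ j $ i else 0 else 0)
          + (if k = j then if l = j then d2 else 0 else 0)) / 4"
        by (simp only: expand sum_divide_distrib)
      also have "\<dots> = ((\<Sum>l\<in>UNIV. x $ l * ?g $ l $ i) * (\<Sum>k\<in>UNIV. x $ k * ?g $ k $ j)
          - 2 * ?g $ j $ i + d2) / 4"
        by (simp add: sum.distrib sum_subtractf sum_product)
      finally show ?thesis
        by (simp add: baran_simplex_contract[OF x] baran_simplex_commute[of x j] power2_eq_square)
    qed
    moreover have "(1 - ?s) / ?s * ?g $ i $ j = d / ?s + 1 / ?s\<^sup>2 - ?g $ i $ j"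
    proof -
      have "?g $ i $ j = d + 1 / ?s"
        by (simp add: baran_simplex_nth d_def)
      then show ?thesis
        using pos(1) by (simp add: field_simps power2_eq_square)
    qed
    ultimately show ?thesis
      by (simp add: field_simps)
  qed
  then show ?thesis by (simp add: vec_eq_iff)
qed

lemma riemannian_metric_on_baran_simplex:
  "riemannian_metric_on open_simplex (baran_simplex :: real^'n::finite \<Rightarrow> _)"
  unfolding riemannian_metric_on_def
proof (intro conjI allI ballI impI)
  show "open (open_simplex :: (real^'n) set)" by (rule open_open_simplex)
next
  fix i j :: 'n
  have "rational_on open_simplex (\<lambda>x::real^'n. (if i = j then 1 else 0) / x $ i + 1 / (1 - (\<Sum>k\<in>UNIV. x $ k)))"
    by (intro rational_on.add rational_on.const rational_on_divide rational_on.coord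
         rational_on_diff rational_on_sum) (auto simp: open_simplex_def, metis less_irrefl)
  then show "smooth_fun_on open_simplex (\<lambda>x::real^'n. baran_simplex x $ i $ j)"
    by (simp add: rational_on_imp_smooth_fun_on open_open_simplex baran_simplex_def)
next
  fix x :: "real^'n"
  show "transpose (baran_simplex x) = baran_simplex x"
    by (simp add: transpose_def vec_eq_iff baran_simplex_commute)
next
  fix x v :: "real^'n"
  assume x: "x \<in> open_simplex" and v: "v \<noteq> 0"
  have "(baran_simplex x *v v) $ i = v $ i / x $ i + (\<Sum>k\<in>UNIV. v $ k) / simplex_gap x" for i
    by (simp add: matrix_vector_mult_def baran_simplex_nth algebra_simps
         sum.distrib if_distrib[of "\<lambda>a. _ * a"] sum_divide_distrib cong: if_cong)
  then have "v \<bullet> (baran_simplex x *v v)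
      = (\<Sum>i\<in>UNIV. (v $ i)\<^sup>2 / x $ i) + (\<Sum>k\<in>UNIV. v $ k)\<^sup>2 / simplex_gap x"
    by (simp add: inner_vec_def algebra_simps power2_eq_square sum.distrib sum_distrib_left[symmetric]
         sum_divide_distrib[symmetric] sum_distrib_right[symmetric])
  also have "\<dots> > 0"
  proof (rule add_pos_nonneg)
    obtain i where "v $ i \<noteq> 0" using v by (auto simp: vec_eq_iff)
    then show "0 < (\<Sum>i\<in>UNIV. (v $ i)\<^sup>2 / x $ i)"
      using open_simplexD(2)[OF x] by (intro sum_pos2[of _ i]) (auto simp: less_imp_le)
    show "0 \<le> (\<Sum>k\<in>UNIV. v $ k)\<^sup>2 / simplex_gap x"
      using open_simplexD(1)[OF x] by simp
  qed
  finally show "0 < v \<bullet> (baran_simplex x *v v)" .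
qed

theorem proposition1p1:
  assumes "CARD('n::finite) \<ge> 2"
  shows "(\<exists>k>0. einstein_manifold k (ball 0 1 :: (real^'n) set) baran_ball) \<and>
         (\<exists>k>0. einstein_manifold k (open_simplex :: (real^'n) set) baran_simplex)"
proof (intro conjI exI)
  show "0 < real CARD('n) - 1" "0 < (real CARD('n) - 1) / 4"
    using assms by auto
  show "einstein_manifold (real CARD('n) - 1) (ball 0 1 :: (real^'n) set) baran_ball"
    by (simp add: einstein_manifold_def riemannian_metric_on_baran_ball ricci_baran_ball del: mem_ball)
  show "einstein_manifold ((real CARD('n) - 1) / 4) (open_simplex :: (real^'n) set) baran_simplex"
    by (simp add: einstein_manifold_def riemannian_metric_on_baran_simplex ricci_baran_simplex)
qed

end
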